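(* Let $n$ be a positive integer and let $x_1,\dots,x_{2n}$ be indeterminates. Then the following two identities hold: $$ \operatorname{Pf}\left(\frac{x_i-x_j}{(x_i+x_j)^2}\right)_{1\le i,j\le 2n} =\prod_{1\le i<j\le 2n}\frac{x_i-x_j}{x_i+x_j}\cdot \operatorname{Hf}\left(\frac{1}{x_i+x_j}\right)_{1\le i,j\le 2n}, $$ $$ \operatorname{Pf}\left(\frac{x_i-x_j}{(1-x_ix_j)^2}\right)_{1\le i,j\le 2n} =\prod_{1\le i<j\le 2n}\frac{x_i-x_j}{1-x_ix_j}\cdot \operatorname{Hf}\left(\frac{1}{1-x_ix_j}\right)_{1\le i,j\le 2n}. $$
   Context: The identities are equalities of rational functions in the indeterminates with complex coefficients. Let $\mathcal{F}_{2n}$ be the set of all permutations $\sigma$ of $\{1,\dots,2n\}$ satisfying $\sigma(1)<\sigma(3)<\cdots<\sigma(2n-1)$ and $\sigma(2i-1)<\sigma(2i)$ for $1\le i\le n$. The Hafnian of a $2n\times 2n$ symmetric matrix $A=(a_{ij})$ is $$\operatorname{Hf}A=\sum_{\sigma\in\mathcal{F}_{2n}}a_{\sigma(1)\sigma(2)}a_{\sigma(3)\sigma(4)}\cdots a_{\sigma(2n-1)\sigma(2n)}$$ (the diagonal entries play no role). The Pfaffian of a $2n\times 2n$ skew-symmetric matrix $A=(a_{ij})$ is $$\operatorname{Pf}A=\sum_{\sigma\in\mathcal{F}_{2n}}\operatorname{sgn}(\sigma)\,a_{\sigma(1)\sigma(2)}a_{\sigma(3)\sigma(4)}\cdots a_{\sigma(2n-1)\sigma(2n)}.$$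 *)

theory Defs
  imports
    Complex_Main
    "HOL-Library.Poly_Mapping"
    "HOL-Computational_Algebra.Fraction_Field"
    "HOL-Combinatorics.Permutations"
begin

text \<open>
  A monomial is a finitely supported exponent function, and a polynomial is a finitely
  supported map from monomials to coefficients. Countably many indeterminates are provided, so
  that one type serves all sizes \<open>2 * n\<close>: the field \<open>\<complex>(x\<^sub>1, \<dots>, x\<^sub>2\<^sub>n)\<close> is a subfield of
  \<open>ratfun\<close>, and an identity between its elements means the same in either field.
\<close>

type_synonym mpoly = "(nat \<Rightarrow>\<^sub>0 nat) \<Rightarrow>\<^sub>0 complex"

type_synonym ratfun = "mpoly fract"

definition indet :: "nat \<Rightarrow> ratfun" where
  "indet i = Fract (Poly_Mapping.single (Poly_Mapping.single i 1) 1) 1"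

definition matching_perms :: "nat \<Rightarrow> (nat \<Rightarrow> nat) set" where
  "matching_perms n =
     {\<sigma>. \<sigma> permutes {1..2*n} \<and>
          (\<forall>i\<in>{1..<n}. \<sigma> (2*i - 1) < \<sigma> (2*i + 1)) \<and>
          (\<forall>i\<in>{1..n}. \<sigma> (2*i - 1) < \<sigma> (2*i))}"

text \<open>
  A \<open>2n \<times> 2n\<close> matrix is a function of two indices in \<open>{1..2*n}\<close>; the first argument below is
  the half-size \<open>n\<close>. Only entries strictly above the diagonal are used.
\<close>

definition hafnian :: "nat \<Rightarrow> (nat \<Rightarrow> nat \<Rightarrow> 'a::comm_ring_1) \<Rightarrow> 'a" where
  "hafnian n A =
     (\<Sum>\<sigma>\<in>matching_perms n. \<Prod>i=1..n. A (\<sigma> (2*i - 1)) (\<sigma> (2*i)))"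

definition pfaffian :: "nat \<Rightarrow> (nat \<Rightarrow> nat \<Rightarrow> 'a::comm_ring_1) \<Rightarrow> 'a" where
  "pfaffian n A =
     (\<Sum>\<sigma>\<in>matching_perms n. of_int (sign \<sigma>) * (\<Prod>i=1..n. A (\<sigma> (2*i - 1)) (\<sigma> (2*i))))"

end

theory Submission
  imports Defs "HOL-Computational_Algebra.Polynomial"
begin

text \<open>
  Let \<open>H(S)\<close> be the Hafnian of \<open>1 / (x\<^sub>i + x\<^sub>j)\<close> on a finite index set \<open>S\<close>, and let
  \<open>s\<^sub>i\<^sub>j = (x\<^sub>i + x\<^sub>j) / (x\<^sub>i - x\<^sub>j)\<close>. Expanding both sides of the first identity along the first
  row and dividing by the product, induction on \<open>n\<close> reduces it to the twisted expansion
  \<open>H(S) = \<Sum>\<^sub>k H(S - {a, k}) / (x\<^sub>a + x\<^sub>k) \<cdot> \<Prod>\<^sub>j s\<^sub>a\<^sub>j s\<^sub>k\<^sub>j\<close>, with \<open>j\<close> ranging over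
  \<open>S - {a, k}\<close>. Without the products this is the ordinary expansion of \<open>H(S)\<close>. As functions
  of \<open>x\<^sub>a\<close> the two expansions have the same poles and residues: at \<open>-x\<^sub>k\<close> this is immediate, and
  at \<open>x\<^sub>m\<close> the residue of the twisted one is a sum over \<open>k\<close> which, by the twisted expansion of
  each \<open>H(S - {a, k})\<close> along \<open>m\<close>, becomes antisymmetric in two indices and hence vanishes.

  The second identity is the first one at \<open>x\<^sub>i = (1 - y\<^sub>i) / (1 + y\<^sub>i)\<close>.
\<close>

subsection \<open>Hafnians indexed by finite sets\<close>

lemma sum_off_diagonal_swap:
  assumes "finite U"
  shows "(\<Sum>k\<in>U. \<Sum>l\<in>U - {k}. f k l) = (\<Sum>l\<in>U. \<Sum>k\<in>U - {l}. f k l)"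
proof -
  have 1: "{l \<in> U. k \<noteq> l} = U - {k}" "{l \<in> U. l \<noteq> k} = U - {k}" for k
    by auto
  show ?thesis
    using sum.swap_restrict[OF assms assms, of f "\<lambda>k l. k \<noteq> l"] by (simp add: 1)
qed

text \<open>Half the size is a separate argument, which makes the recursion primitive; the value is
  the Hafnian on \<open>S\<close> when \<open>card S = 2 * n\<close>. Pairing off
  \<open>Min S\<close> first mirrors the expansion along the first row of a matrix indexed by
  \<open>S\<close> in increasing order.\<close>

primrec set_hafnian :: "('i::linorder \<Rightarrow> 'i \<Rightarrow> 'a::comm_ring_1) \<Rightarrow> nat \<Rightarrow> 'i set \<Rightarrow> 'a" where
  "set_hafnian A 0 S = 1"
| "set_hafnian A (Suc n) S =
     (\<Sum>k\<in>S - {Min S}. A (Min S) k * set_hafnian A n (S - {Min S, k}))"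

text \<open>Expanding along \<open>b = Min S\<close> and then along \<open>a\<close>, or in the
  opposite order, yields the same double sum over the partners of \<open>a\<close> and
  \<open>b\<close>. Symmetry of \<open>A\<close> serves the case where \<open>a\<close> and
  \<open>b\<close> are partners.\<close>

lemma set_hafnian_expand:
  assumes sym: "\<And>i j. A i j = A j i"
    and "card S = 2 * n + 2" "a \<in> S"
  shows "set_hafnian A (Suc n) S = (\<Sum>k\<in>S - {a}. A a k * set_hafnian A n (S - {a, k}))"
  using assms(2,3)
proof (induction n arbitrary: S a)
  case (0 S a)
  then have "card (S - {a}) = 1"
    by simp
  then obtain b where "S - {a} = {b}"
    by (auto simp: card_1_singleton_iff)
  then have b: "S = {a, b}" "a \<noteq> b"
    using 0 by auto
  have "Min S = a \<or> Min S = b"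
    using b Min_in[of S] by auto
  then show ?case
  proof
    assume M: "Min S = a"
    show ?case by (simp add: M)
  next
    assume M: "Min S = b"
    have "S - {a} = {b}" "S - {b} = {a}"
      using b by auto
    then show ?case by (simp add: M sym[of a b])
  qed
next
  case (Suc m S a)
  have fin: "finite S"
    by (rule card_ge_0_finite) (simp add: Suc.prems(1))
  define b where "b = Min S"
  have bS: "b \<in> S"
    unfolding b_def using fin Suc.prems(2) by (intro Min_in) auto
  show ?case
  proof (cases "a = b")
    case True
    then show ?thesis by (simp add: b_def)
  next
    case False
    define U where "U = S - {a, b}"
    have finU: "finite U" using fin by (simp add: U_def)
    \<comment> \<open>\<open>F k l\<close> collects the matchings that pair \<open>b\<close> with
      \<open>k\<close> and \<open>a\<close> with \<open>l\<close>.\<close>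
    define F where "F k l = A b k * A a l * set_hafnian A m (S - {a, b, k, l})" for k l
    have Sb: "S - {b} = insert a U" "a \<notin> U" and Sa: "S - {a} = insert b U" "b \<notin> U"
      using False bS Suc.prems by (auto simp: U_def)
    have cardU: "card (S - {c, k}) = 2 * m + 2" if "c \<in> S" "k \<in> S" "c \<noteq> k" for c k
      using that Suc.prems fin by (simp add: card_Diff_subset)
    have L: "A b k * set_hafnian A (Suc m) (S - {b, k}) = (\<Sum>l\<in>U - {k}. F k l)" if "k \<in> U" for k
    proof -
      have E: "S - {b, k} - {a} = U - {k}" "\<And>l. S - {b, k} - {a, l} = S - {a, b, k, l}"
        by (auto simp: U_def)
      have "card (S - {b, k}) = 2 * m + 2" "a \<in> S - {b, k}"
        using cardU[of b k] that bS False Suc.prems(2) by (auto simp: U_def)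
      note IH = Suc.IH[OF this]
      show ?thesis
        unfolding IH E F_def sum_distrib_left by (simp only: mult_ac)
    qed
    have R: "A a l * set_hafnian A (Suc m) (S - {a, l}) = (\<Sum>k\<in>U - {l}. F k l)" if "l \<in> U" for l
    proof -
      have E: "S - {a, l} - {b} = U - {l}" "\<And>k. S - {a, l} - {b, k} = S - {a, b, k, l}"
        by (auto simp: U_def)
      have "card (S - {a, l}) = 2 * m + 2" "b \<in> S - {a, l}"
        using cardU[of a l] that bS False Suc.prems(2) by (auto simp: U_def)
      note IH = Suc.IH[OF this]
      show ?thesis
        unfolding IH E F_def sum_distrib_left by (simp only: mult_ac)
    qed
    have "set_hafnian A (Suc (Suc m)) S =
        (\<Sum>k\<in>S - {b}. A b k * set_hafnian A (Suc m) (S - {b, k}))"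
      by (simp only: b_def set_hafnian.simps(2)[of A "Suc m"])
    also have "\<dots> = A b a * set_hafnian A (Suc m) (S - {b, a}) + (\<Sum>k\<in>U. \<Sum>l\<in>U - {k}. F k l)"
      unfolding Sb(1) using finU Sb(2) L by (simp del: set_hafnian.simps)
    also have "\<dots> = A a b * set_hafnian A (Suc m) (S - {a, b}) + (\<Sum>l\<in>U. \<Sum>k\<in>U - {l}. F k l)"
      unfolding sym[of b a] insert_commute[of b a]
      by (rule arg_cong[OF sum_off_diagonal_swap[OF finU]])
    also have "\<dots> = (\<Sum>k\<in>S - {a}. A a k * set_hafnian A (Suc m) (S - {a, k}))"
      unfolding Sa(1) using finU Sa(2) R by (simp del: set_hafnian.simps)
    finally show ?thesis .
  qed
qed

subsection \<open>The twisted expansion of the Hafnian\<close>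

text \<open>The case \<open>i = j\<close> of \<open>add_nonzero\<close> is deliberate: it excludes
  nodes equal to zero and characteristic 2.\<close>

locale schur_nodes =
  fixes x :: "'i::linorder \<Rightarrow> 'a::field"
  assumes add_nonzero: "x i + x j \<noteq> 0"
    and distinct: "i \<noteq> j \<Longrightarrow> x i \<noteq> x j"
begin

abbreviation w :: "'i \<Rightarrow> 'i \<Rightarrow> 'a" where "w i j \<equiv> 1 / (x i + x j)"
abbreviation s :: "'i \<Rightarrow> 'i \<Rightarrow> 'a" where "s i j \<equiv> (x i + x j) / (x i - x j)"
abbreviation H :: "nat \<Rightarrow> 'i set \<Rightarrow> 'a" where "H \<equiv> set_hafnian w"

lemma two_nonzero: "(2::'a) \<noteq> 0"
  using add_nonzero[of undefined undefined] by (auto simp flip: mult_2)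

text \<open>
  Expanding every \<open>H (Suc n) (T - {k})\<close> along \<open>m\<close> gives a double sum over \<open>k \<noteq> l\<close> that is
  antisymmetric in \<open>k\<close> and \<open>l\<close>.
\<close>

lemma vanishing_sum:
  assumes expand: "\<And>S a. card S = 2 * n + 2 \<Longrightarrow> a \<in> S \<Longrightarrow>
      H (Suc n) S = (\<Sum>k\<in>S - {a}. w a k * (\<Prod>j\<in>S - {a, k}. s a j * s k j) * H n (S - {a, k}))"
    and card: "card T = 2 * n + 3" and m: "m \<in> T"
  shows "(\<Sum>k\<in>T - {m}. H (Suc n) (T - {k}) * (\<Prod>j\<in>T - {k}. s k j) * (x m - x k) / (x m + x k)^2) = 0"
proof -
  have fin: "finite T"
    by (rule card_ge_0_finite) (simp add: card)
  define U where "U = T - {m}"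
  have finU: "finite U" using fin by (simp add: U_def)
  \<comment> \<open>Every factor except \<open>s k l\<close> is symmetric in \<open>k\<close> and
    \<open>l\<close>.\<close>
  define F where "F k l = - s k l * w m k * w m l * H n (T - {k, l, m}) *
      ((\<Prod>j\<in>T - {k, l, m}. s k j) * (\<Prod>j\<in>T - {k, l, m}. s l j) * (\<Prod>j\<in>T - {k, l, m}. s m j))" for k l
  have F_anti: "F k l = - F l k" if "k \<noteq> l" for k l
  proof -
    have "s k l = (x l + x k) / - (x l - x k)"
      unfolding minus_diff_eq add.commute[of "x l"] ..
    also have "\<dots> = - s l k"
      by (rule divide_minus_right)
    finally have "s k l = - s l k" .
    then show ?thesis
      by (simp add: F_def insert_commute[of k l] mult_ac)
  qed
  have term_eq: "H (Suc n) (T - {k}) * (\<Prod>j\<in>T - {k}. s k j) * (x m - x k) / (x m + x k)^2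
      = (\<Sum>l\<in>U - {k}. F k l)" if k: "k \<in> U" for k
  proof -
    have km: "k \<noteq> m" "k \<in> T" using k by (auto simp: U_def)
    have "T - {k} - {m} = U - {k}" "\<And>l. T - {k} - {m, l} = T - {k, l, m}"
      by (auto simp: U_def)
    then have H: "H (Suc n) (T - {k}) =
        (\<Sum>l\<in>U - {k}. w m l * (\<Prod>j\<in>T - {k, l, m}. s m j * s l j) * H n (T - {k, l, m}))"
      using expand[of "T - {k}" m] card m km fin by (simp del: set_hafnian.simps)
    have "w m l * (\<Prod>j\<in>T - {k, l, m}. s m j * s l j) * H n (T - {k, l, m})
        * (\<Prod>j\<in>T - {k}. s k j) * (x m - x k) / (x m + x k)^2 = F k l" if l: "l \<in> U - {k}" for l
    proof -
      have "T - {k} = insert m (insert l (T - {k, l, m}))" "m \<noteq> l"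
        using l km m by (auto simp: U_def)
      then have P: "(\<Prod>j\<in>T - {k}. s k j) = s k m * (s k l * (\<Prod>j\<in>T - {k, l, m}. s k j))"
        using fin by simp
      \<comment> \<open>The factor \<open>s k m\<close> cancels against the double pole and leaves
        \<open>- w m k\<close>, the counterpart of \<open>w m l\<close>; this is what makes the
        remaining weight symmetric.\<close>
      have E: "w m l * s k m * s k l * ((x m - x k) / (x m + x k)^2) = - s k l * w m k * w m l"
      proof -
        have "x k - x m \<noteq> 0" using distinct[OF km(1)] by simp
        moreover have "x m - x k = - (x k - x m)" by simp
        ultimately have 1: "s k m * ((x m - x k) / (x m + x k)^2) = - w m k"
          using add_nonzero[of m k] by (simp add: power2_eq_square add.commute divide_simps)
        have "p * q * r * t = p * r * (q * t)" for p q r t :: 'a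
          by (simp add: mult_ac)
        then show ?thesis
          by (simp only: 1) (simp only: mult_minus_left mult_minus_right mult_ac)
      qed
      have alg: "p * (q * r) * h * (b * (c * t)) * d / e = (p * b * c * (d / e)) * h * (t * r * q)"
        for p q r h b c t d e :: 'a
        by (simp add: mult_ac)
      show ?thesis
        unfolding P F_def prod.distrib alg E ..
    qed
    then show ?thesis
      unfolding H by (simp add: sum_distrib_right sum_divide_distrib)
  qed
  define X where "X = (\<Sum>k\<in>U. \<Sum>l\<in>U - {k}. F k l)"
  have "X = (\<Sum>k\<in>U. \<Sum>l\<in>U - {k}. - F l k)"
    unfolding X_def using F_anti by (intro sum.cong refl) auto
  also have "\<dots> = - X"
    unfolding X_def by (subst sum_off_diagonal_swap[OF finU]) (simp add: sum_negf)
  finally have "X + X = 0" by (rule eq_neg_iff_add_eq_0[THEN iffD1])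
  then have "2 * X = 0" by (simp only: mult_2)
  then have "X = 0" using two_nonzero by simp
  with sum.cong[OF refl term_eq] show ?thesis
    unfolding X_def U_def[symmetric] by (rule trans)
qed

text \<open>
  Regard \<open>x a\<close> as a variable and clear denominators. The difference of the two sides becomes a
  polynomial \<open>G\<close> of degree below \<open>2 * card T\<close> with the roots \<open>x m\<close> and \<open>- x m\<close> for \<open>m \<in> T\<close>:
  the first by the vanishing assumption, the second since there only the term \<open>k = m\<close> survives
  and its two parts cancel, which uses that \<open>card T\<close> is odd.
\<close>

lemma twisted_sum_eq:
  assumes vanish: "\<And>m. m \<in> T \<Longrightarrow>
      (\<Sum>k\<in>T - {m}. h k * (\<Prod>j\<in>T - {k}. s k j) * (x m - x k) / (x m + x k)^2) = 0"
    and odd: "odd (card T)" and a: "a \<notin> T"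
  shows "(\<Sum>k\<in>T. w a k * (\<Prod>j\<in>T - {k}. s a j * s k j) * h k) = (\<Sum>k\<in>T. w a k * h k)"
proof -
  have fin: "finite T"
    by (rule card_ge_0_finite) (use odd in \<open>auto intro: Nat.gr0I\<close>)
  define c where "c k = (\<Prod>j\<in>T - {k}. s k j)" for k
  define L where "L k = (\<Prod>j\<in>T - {k}. [:x j, 1:])" for k
  define M where "M = (\<Prod>j\<in>T. [:- x j, 1:])"
  \<comment> \<open>At \<open>x a\<close>, \<open>N k\<close> divided by \<open>M\<close> is the
    twisting product of the term \<open>k\<close> minus 1.\<close>
  define N where "N k = smult (c k) ([:- x k, 1:] * L k) - M" for k
  define G where "G = (\<Sum>k\<in>T. smult (h k) (N k * L k))"
  have poly_L: "poly (L k) z = (\<Prod>j\<in>T - {k}. z + x j)" for k z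
    by (simp add: L_def poly_prod add.commute)
  have poly_M: "poly M z = (\<Prod>j\<in>T. z - x j)" for z
    by (simp add: M_def poly_prod)
  have poly_N: "poly (N k) z = c k * ((z - x k) * poly (L k) z) - poly M z" for k z
    by (simp add: N_def algebra_simps)
  have poly_G: "poly G z = (\<Sum>k\<in>T. h k * ((c k * ((z - x k) * poly (L k) z) - poly M z) * poly (L k) z))" for z
    by (simp add: G_def poly_N poly_sum)
  have L_split: "poly (L k) z * (z + x k) = (\<Prod>j\<in>T. z + x j)" if "k \<in> T" for k z
    using that fin by (simp add: poly_L prod.remove mult.commute)
  have M_split: "poly M z = (z - x k) * (\<Prod>j\<in>T - {k}. z - x j)" if "k \<in> T" for k z
    using that fin by (simp add: poly_M prod.remove)
  have root_pos: "poly G (x m) = 0" if m: "m \<in> T" for m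
  proof -
    \<comment> \<open>The term \<open>k = m\<close> drops out as well, through its factor
      \<open>x m - x k\<close>. The remaining terms share the square of the full product of the
      \<open>x m + x j\<close>, and what is left is the assumed vanishing sum.\<close>
    have M0: "poly M (x m) = 0" using M_split[OF m] by simp
    have "poly G (x m) = (\<Sum>k\<in>T - {m}. h k * (c k * ((x m - x k) * poly (L k) (x m)) * poly (L k) (x m)))"
      unfolding poly_G M0 using fin m by (simp add: sum.remove)
    also have "\<dots> = (\<Sum>k\<in>T - {m}. (\<Prod>j\<in>T. x m + x j)^2 * (h k * c k * (x m - x k) / (x m + x k)^2))"
    proof (intro sum.cong refl)
      fix k assume "k \<in> T - {m}"
      then have "(\<Prod>j\<in>T. x m + x j) = poly (L k) (x m) * (x m + x k)"
        using L_split[of k "x m"] by simp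
      then show "h k * (c k * ((x m - x k) * poly (L k) (x m)) * poly (L k) (x m)) =
          (\<Prod>j\<in>T. x m + x j)^2 * (h k * c k * (x m - x k) / (x m + x k)^2)"
        using add_nonzero[of m k] by (simp add: power2_eq_square divide_simps)
    qed
    also have "\<dots> = 0"
      unfolding sum_distrib_left[symmetric] c_def using vanish[OF m] by simp
    finally show ?thesis .
  qed
  have root_neg: "poly G (- x m) = 0" if m: "m \<in> T" for m
  proof -
    have "poly (L k) (- x m) = 0" if "k \<in> T" "k \<noteq> m" for k
      unfolding poly_L using fin m that by (auto intro!: prod_zero bexI[of _ m])
    moreover have "c m * ((- x m - x m) * poly (L m) (- x m)) - poly M (- x m) = 0"
    proof -
      have even: "even (card (T - {m}))" using odd fin m by simp
      have neg: "(\<Prod>j\<in>T - {m}. - f j) = (\<Prod>j\<in>T - {m}. f j)" for f :: "'i \<Rightarrow> 'a"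
        using even by (simp add: prod_uminus)
      have "poly (L m) (- x m) = (\<Prod>j\<in>T - {m}. x m - x j)"
        unfolding poly_L neg[symmetric, of "\<lambda>j. x m - x j"] by simp
      moreover have "poly M (- x m) = (- x m - x m) * (\<Prod>j\<in>T - {m}. x m + x j)"
        unfolding M_split[OF m] neg[symmetric, of "\<lambda>j. x m + x j"] by simp
      moreover have "c m * (\<Prod>j\<in>T - {m}. x m - x j) = (\<Prod>j\<in>T - {m}. x m + x j)"
        unfolding c_def prod.distrib[symmetric] using distinct by (intro prod.cong) auto
      ultimately show ?thesis by (simp add: mult_ac)
    qed
    ultimately show ?thesis
      unfolding poly_G by (intro sum.neutral ballI) (metis mult_zero_left mult_zero_right)
  qed
  have "G = 0"
  proof (cases "T = {}")
    case True
    then show ?thesis by (simp add: G_def)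
  next
    case False
    then have pos: "card T > 0" using fin by (simp add: card_gt_0_iff)
    have degL: "degree (L k) \<le> card T - 1" if "k \<in> T" for k
      using fin that degree_prod_sum_le[of "T - {k}" "\<lambda>j. [:x j, 1:]"] by (simp add: L_def)
    have degM: "degree M \<le> card T"
      using fin degree_prod_sum_le[of T "\<lambda>j. [:- x j, 1:]"] by (simp add: M_def)
    have degN: "degree (N k) \<le> card T" if "k \<in> T" for k
    proof -
      have "degree ([:- x k, 1:] * L k) \<le> 1 + (card T - 1)"
        by (rule order_trans[OF degree_mult_le]) (use degL[OF that] in simp)
      then show ?thesis
        unfolding N_def using pos degM
        by (intro degree_diff_le order_trans[OF degree_smult_le]) auto
    qed
    have "degree (smult (h k) (N k * L k)) \<le> 2 * card T - 1" if "k \<in> T" for k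
      by (rule order_trans[OF degree_smult_le], rule order_trans[OF degree_mult_le])
         (use degL[OF that] degN[OF that] pos in linarith)
    then have degG: "degree G \<le> 2 * card T - 1"
      unfolding G_def using fin by (intro degree_sum_le) auto
    have inj: "inj_on x T" "inj_on (\<lambda>m. - x m) T"
      using distinct by (auto simp: inj_on_def)
    \<comment> \<open>The two families of roots are disjoint because no sum of two nodes vanishes,
      equal indices included.\<close>
    have disj: "x ` T \<inter> (\<lambda>m. - x m) ` T = {}"
      using add_nonzero by (auto simp: eq_neg_iff_add_eq_0)
    have "card (x ` T \<union> (\<lambda>m. - x m) ` T) = 2 * card T"
      using fin inj disj by (simp add: card_Un_disjoint card_image)
    then show ?thesis
      using pos degG root_pos root_neg
      by (intro poly_eqI_degree[of "x ` T \<union> (\<lambda>m. - x m) ` T"]) auto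
  qed
  then have G0: "poly G (x a) = 0" by simp
  \<comment> \<open>\<open>C\<close> is the common denominator at \<open>x a\<close>: it turns the
    difference of the two terms for \<open>k\<close> into the summand for \<open>k\<close> of
    \<open>poly G (x a)\<close>.\<close>
  define C where "C = (\<Prod>j\<in>T. x a - x j) * (\<Prod>j\<in>T. x a + x j)"
  have ne: "x a - x j \<noteq> 0" if "j \<in> T" for j
    using distinct[of a j] a that by auto
  have "C \<noteq> 0"
    using fin ne add_nonzero by (auto simp: C_def)
  have "C * (\<Sum>k\<in>T. w a k * (\<Prod>j\<in>T - {k}. s a j * s k j) * h k - w a k * h k) = poly G (x a)"
    unfolding poly_G sum_distrib_left
  proof (intro sum.cong refl)
    fix k assume k: "k \<in> T"
    have 1: "(\<Prod>j\<in>T - {k}. x a - x j) * (\<Prod>j\<in>T - {k}. s a j) = poly (L k) (x a)"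
      unfolding poly_L prod.distrib[symmetric] using ne by (intro prod.cong) auto
    have 2: "(\<Prod>j\<in>T. x a + x j) * w a k = poly (L k) (x a)"
      using L_split[OF k, of "x a", symmetric] add_nonzero[of a k] by simp
    have "C * (w a k * (\<Prod>j\<in>T - {k}. s a j * s k j) * h k - w a k * h k)
      = h k * (((\<Prod>j\<in>T. x a - x j) * (\<Prod>j\<in>T - {k}. s a j)) * c k - (\<Prod>j\<in>T. x a - x j))
         * ((\<Prod>j\<in>T. x a + x j) * w a k)"
      unfolding C_def prod.distrib c_def by (simp add: algebra_simps)
    also have "(\<Prod>j\<in>T. x a - x j) * (\<Prod>j\<in>T - {k}. s a j) = (x a - x k) * poly (L k) (x a)"
      unfolding 1[symmetric] using fin k by (simp add: prod.remove)
    finally show "C * (w a k * (\<Prod>j\<in>T - {k}. s a j * s k j) * h k - w a k * h k) =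
        h k * ((c k * ((x a - x k) * poly (L k) (x a)) - poly M (x a)) * poly (L k) (x a))"
      unfolding 2 poly_M by (simp add: mult_ac)
  qed
  then show ?thesis
    using G0 \<open>C \<noteq> 0\<close> by (simp add: sum_subtractf)
qed

text \<open>For two indices the products are empty. In the induction step the twisted expansion of
  the smaller Hafnians yields the vanishing sums on \<open>T = S - {a}\<close>, a set of odd size,
  and these allow the twisting products to be inserted into the ordinary expansion.\<close>

lemma set_hafnian_twisted_expand:
  assumes "card S = 2 * n + 2" "a \<in> S"
  shows "H (Suc n) S = (\<Sum>k\<in>S - {a}. w a k * (\<Prod>j\<in>S - {a, k}. s a j * s k j) * H n (S - {a, k}))"
  using assms
proof (induction n arbitrary: S a)
  case (0 S a)
  then have "card (S - {a}) = 1"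
    by simp
  then obtain b where "S - {a} = {b}"
    by (auto simp: card_1_singleton_iff)
  then have b: "S = {a, b}" "a \<noteq> b"
    using 0 by auto
  then have E: "S - {a} = {b}" "S - {a, b} = {}"
    by auto
  have H: "H (Suc 0) S = (\<Sum>k\<in>S - {a}. w a k * H 0 (S - {a, k}))"
    using 0 by (intro set_hafnian_expand) (simp_all add: add.commute)
  show ?case
    unfolding H E(1) by (simp add: E(2))
next
  case (Suc n S a)
  have fin: "finite S"
    by (rule card_ge_0_finite) (simp add: Suc.prems(1))
  define T where "T = S - {a}"
  have T: "S - {a, k} = T - {k}" for k by (auto simp: T_def)
  have card: "card T = 2 * n + 3" using Suc.prems fin by (simp add: T_def)
  have "H (Suc (Suc n)) S = (\<Sum>k\<in>T. w a k * H (Suc n) (T - {k}))"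
    using set_hafnian_expand[of w S "Suc n" a] Suc.prems
    unfolding T T_def[symmetric] by (simp add: add.commute)
  also have "\<dots> = (\<Sum>k\<in>T. w a k * (\<Prod>j\<in>T - {k}. s a j * s k j) * H (Suc n) (T - {k}))"
    using card
    by (intro twisted_sum_eq[symmetric] vanishing_sum Suc.IH) (auto simp: T_def)
  finally show ?case
    unfolding T T_def[symmetric] .
qed

end

subsection \<open>Expansion along the first row\<close>

text \<open>
  A permutation \<open>\<tau> \<in> matching_perms (Suc n)\<close> with \<open>\<tau> 2 = k\<close> is a permutation in
  \<open>matching_perms n\<close>, moved up by two places, followed by the cycle \<open>2 \<mapsto> k\<close>, \<open>i \<mapsto> i - 1\<close> for
  \<open>2 < i \<le> k\<close>, whose sign is \<open>(-1)^k\<close>.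
\<close>

definition insert_cycle :: "nat \<Rightarrow> nat \<Rightarrow> nat" where
  "insert_cycle k i = (if i = 2 then k else if 2 < i \<and> i \<le> k then i - 1 else i)"

text \<open>On positive \<open>i\<close>, and for \<open>k\<close> at least 2, this is the
  increasing enumeration of the numbers from 2 on without \<open>k\<close>: it relabels the matrix
  left after deleting rows and columns 1 and \<open>k\<close>.\<close>

definition skip_index :: "nat \<Rightarrow> nat \<Rightarrow> nat" where
  "skip_index k i = (if i + 1 < k then i + 1 else i + 2)"

lemma insert_cycle_add_2: "i \<ge> 1 \<Longrightarrow> insert_cycle k (i + 2) = skip_index k i"
  by (auto simp: insert_cycle_def skip_index_def)

lemma skip_index_less_iff: "skip_index k i < skip_index k j \<longleftrightarrow> i < j"
  by (auto simp: skip_index_def)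

lemma skip_index_image:
  assumes "k \<in> {2..m + 2}"
  shows "skip_index k ` {1..m} = {2..m + 2} - {k}"
proof (intro equalityI subsetI)
  fix j assume "j \<in> {2..m + 2} - {k}"
  then have "j = skip_index k (if j < k then j - 1 else j - 2)" "(if j < k then j - 1 else j - 2) \<in> {1..m}"
    using assms by (auto simp: skip_index_def)
  then show "j \<in> skip_index k ` {1..m}" by blast
qed (use assms in \<open>auto simp: skip_index_def\<close>)

text \<open>The cycle is the identity for \<open>k = 2\<close>, and raising \<open>k\<close> by one
  composes it with one adjacent transposition.\<close>

lemma insert_cycle_permutes_sign:
  assumes "k \<ge> 2"
  shows "insert_cycle k permutes {2..k} \<and> sign (insert_cycle k) = (-1) ^ k"
  using assms
proof (induction k rule: nat_induct_at_least)
  case base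
  have "insert_cycle 2 = id"
    by (auto simp: insert_cycle_def fun_eq_iff)
  show ?case unfolding \<open>insert_cycle 2 = id\<close> by (simp add: permutes_id sign_id del: id_apply)
next
  case (Suc k)
  have eq: "insert_cycle (Suc k) = transpose k (Suc k) \<circ> insert_cycle k"
    using Suc.hyps by (auto simp: insert_cycle_def fun_eq_iff transpose_def)
  have p1: "insert_cycle k permutes {2..Suc k}"
    using Suc.IH by (auto intro: permutes_subset)
  have p2: "transpose k (Suc k) permutes {2..Suc k}"
    using Suc.hyps by (intro permutes_swap_id) auto
  have "sign (insert_cycle (Suc k)) = sign (transpose k (Suc k)) * sign (insert_cycle k)"
    unfolding eq using p1 p2 by (intro sign_compose) (auto simp: permutation_permutes)
  moreover have "insert_cycle (Suc k) permutes {2..Suc k}"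
    unfolding eq by (rule permutes_compose[OF p1 p2])
  ultimately show ?case
    using Suc.IH by (simp add: sign_swap_id)
qed

definition extend_perm :: "nat \<Rightarrow> nat \<Rightarrow> (nat \<Rightarrow> nat) \<Rightarrow> nat \<Rightarrow> nat" where
  "extend_perm n k \<sigma> = insert_cycle k \<circ> map_permutation {1..2*n} (\<lambda>i. i + 2) \<sigma>"

lemma bij_betw_add_2: "bij_betw (\<lambda>i. i + 2) {1..2*n} {3..2*n + 2::nat}"
  by (rule bij_betw_byWitness[where f' = "\<lambda>i. i - 2"]) auto

context
  fixes n k :: nat and \<sigma> :: "nat \<Rightarrow> nat"
  assumes \<sigma>: "\<sigma> permutes {1..2*n}" and k: "k \<in> {2..2*n + 2}"
begin

lemma shifted_permutes: "map_permutation {1..2*n} (\<lambda>i. i + 2) \<sigma> permutes {3..2*n + 2}"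
  by (rule map_permutation_permutes[OF bij_betw_add_2 \<sigma>])

lemma extend_perm_permutes: "extend_perm n k \<sigma> permutes {1..2 * Suc n}"
proof -
  have "insert_cycle k permutes {1..2 * Suc n}"
    using insert_cycle_permutes_sign[of k] k by (auto intro: permutes_subset)
  moreover have "map_permutation {1..2*n} (\<lambda>i. i + 2) \<sigma> permutes {1..2 * Suc n}"
    by (rule permutes_subset[OF shifted_permutes]) auto
  ultimately show ?thesis
    unfolding extend_perm_def by (intro permutes_compose)
qed

lemma sign_extend_perm: "sign (extend_perm n k \<sigma>) = (-1) ^ k * sign \<sigma>"
proof -
  have "sign (extend_perm n k \<sigma>)
      = sign (insert_cycle k) * sign (map_permutation {1..2*n} (\<lambda>i. i + 2) \<sigma>)"
    unfolding extend_perm_def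
    using insert_cycle_permutes_sign[of k] shifted_permutes k
    by (intro sign_compose) (auto simp: permutation_permutes)
  also have "sign (map_permutation {1..2*n} (\<lambda>i. i + 2) \<sigma>) = sign \<sigma>"
    using \<sigma> by (intro sign_map_permutation) (auto simp: inj_on_def)
  finally show ?thesis
    using insert_cycle_permutes_sign[of k] k by simp
qed

lemma extend_perm_simps:
  shows "extend_perm n k \<sigma> (Suc 0) = 1" "extend_perm n k \<sigma> 2 = k"
    and "i \<in> {1..2*n} \<Longrightarrow> extend_perm n k \<sigma> (i + 2) = skip_index k (\<sigma> i)"
proof -
  have "map_permutation {1..2*n} (\<lambda>i. i + 2) \<sigma> j = j" if "j < 3" for j
    using that by (intro permutes_not_in[OF shifted_permutes]) auto
  then show "extend_perm n k \<sigma> (Suc 0) = 1" "extend_perm n k \<sigma> 2 = k"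
    by (auto simp: extend_perm_def insert_cycle_def)
  assume i: "i \<in> {1..2*n}"
  then have "\<sigma> i \<ge> 1"
    using permutes_in_image[OF \<sigma>, of i] by auto
  then show "extend_perm n k \<sigma> (i + 2) = skip_index k (\<sigma> i)"
    unfolding extend_perm_def o_def using i
    by (subst map_permutation_apply) (auto simp: inj_on_def insert_cycle_add_2 simp del: add_2_eq_Suc')
qed

lemma skip_index_greater_1: "i \<in> {1..2*n} \<Longrightarrow> 1 < skip_index k i"
  using k by (auto simp: skip_index_def)

text \<open>Since \<open>skip_index k\<close> is strictly increasing, comparisons from position 3 on
  are those of \<sigma>; the others have the value 1 on the left and hold automatically. Both
  directions enter the bijection below.\<close>

lemma extend_perm_in_matching_perms_iff:
  "extend_perm n k \<sigma> \<in> matching_perms (Suc n) \<longleftrightarrow> \<sigma> \<in> matching_perms n"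
proof -
  let ?E = "extend_perm n k \<sigma>"
  have E: "?E (i + 2) < ?E (j + 2) \<longleftrightarrow> \<sigma> i < \<sigma> j" if "i \<in> {1..2*n}" "j \<in> {1..2*n}" for i j
    using that by (simp only: extend_perm_simps skip_index_less_iff)
  have first: "?E (2 * 1 - 1) < ?E (2 * 1 + 1)" if "1 \<le> n"
  proof -
    have 1: "1 \<in> {1..2*n}" using that by simp
    have "1 < ?E (1 + 2)"
      unfolding extend_perm_simps(3)[OF 1]
      by (rule skip_index_greater_1) (use 1 in \<open>simp only: permutes_in_image[OF \<sigma>]\<close>)
    then show ?thesis by (simp add: extend_perm_simps(1) numeral_3_eq_3)
  qed
  have "(\<forall>i\<in>{1..<Suc n}. ?E (2 * i - 1) < ?E (2 * i + 1)) \<longleftrightarrow>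
      (\<forall>i\<in>{1..<n}. \<sigma> (2 * i - 1) < \<sigma> (2 * i + 1))"
  proof -
    have "?E (2 * Suc i - 1) < ?E (2 * Suc i + 1) \<longleftrightarrow> \<sigma> (2 * i - 1) < \<sigma> (2 * i + 1)"
      if "i \<in> {1..<n}" for i
    proof -
      have idx: "2 * i - 1 + 2 = 2 * Suc i - 1" "2 * i + 1 + 2 = 2 * Suc i + 1"
        and "2 * i - 1 \<in> {1..2*n}" "2 * i + 1 \<in> {1..2*n}"
        using that by auto
      from E[OF this(3,4)] show ?thesis unfolding idx .
    qed
    \<comment> \<open>For \<open>n = 0\<close> there is only one odd position and nothing to
      compare, hence the case distinction.\<close>
    moreover have "{1..<Suc n} = (if 1 \<le> n then insert 1 (Suc ` {1..<n}) else {})"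
      unfolding image_Suc_atLeastLessThan by auto
    ultimately show ?thesis
      using first by (simp only: ball_simps split: if_splits) auto
  qed
  moreover have "(\<forall>i\<in>{1..Suc n}. ?E (2 * i - 1) < ?E (2 * i)) \<longleftrightarrow>
      (\<forall>i\<in>{1..n}. \<sigma> (2 * i - 1) < \<sigma> (2 * i))"
  proof -
    have "?E (2 * Suc i - 1) < ?E (2 * Suc i) \<longleftrightarrow> \<sigma> (2 * i - 1) < \<sigma> (2 * i)" if "i \<in> {1..n}" for i
    proof -
      have idx: "2 * i - 1 + 2 = 2 * Suc i - 1" "2 * i + 2 = 2 * Suc i"
        and "2 * i - 1 \<in> {1..2*n}" "2 * i \<in> {1..2*n}"
        using that by auto
      from E[OF this(3,4)] show ?thesis unfolding idx .
    qed
    moreover have "{1..Suc n} = insert 1 (Suc ` {1..n})"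
      unfolding image_Suc_atLeastAtMost by auto
    moreover have "?E (2 * 1 - 1) < ?E (2 * 1)"
      using k by (simp add: extend_perm_simps)
    ultimately show ?thesis by (simp only: ball_simps) auto
  qed
  ultimately show ?thesis
    unfolding matching_perms_def using \<sigma> extend_perm_permutes by simp
qed

end

text \<open>The value 1 cannot sit at an even position, whose predecessor would carry a smaller
  value; at an odd position, monotonicity along the odd positions bounds \<tau>\<open>1\<close> by
  it.\<close>

lemma matching_perms_first:
  assumes "\<tau> \<in> matching_perms (Suc n)"
  shows "\<tau> 1 = 1"
proof -
  have perm: "\<tau> permutes {1..2 * Suc n}"
    using assms by (simp add: matching_perms_def)
  have pos: "\<tau> i \<ge> 1" if "i \<in> {1..2 * Suc n}" for i
    using permutes_in_image[OF perm, of i] that by simp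
  have mono: "\<tau> 1 \<le> \<tau> (2 * i - 1)" if "1 \<le> i" "i \<le> Suc n" for i
    using that
  proof (induction i rule: nat_induct_at_least)
    case (Suc i)
    then have "\<tau> (2 * i - 1) < \<tau> (2 * i + 1)"
      using assms by (auto simp: matching_perms_def)
    with Suc show ?case by simp
  qed simp
  have "1 \<in> \<tau> ` {1..2 * Suc n}"
    using permutes_image[OF perm] by simp
  then obtain p where p: "p \<in> {1..2 * Suc n}" "\<tau> p = 1"
    by (metis imageE)
  show ?thesis
  proof (cases "even p")
    case True
    then obtain i where "p = 2 * i" by blast
    then have "i \<in> {1..Suc n}" "p = 2 * i" using p by auto
    moreover have "\<forall>i\<in>{1..Suc n}. \<tau> (2 * i - 1) < \<tau> (2 * i)"
      using assms unfolding matching_perms_def by blast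
    ultimately have "\<tau> (2 * i - 1) < 1" "2 * i - 1 \<in> {1..2 * Suc n}"
      using p(2) by fastforce+
    then show ?thesis using pos[of "2 * i - 1"] by simp
  next
    case False
    then obtain i where "p = 2 * i + 1" by (rule oddE)
    then show ?thesis
      using mono[of "Suc i"] p pos[of 1] by simp
  qed
qed

text \<open>The partner \<open>k\<close> of 1 is read off at position 2, and \<sigma> is then
  recovered by injectivity of \<open>skip_index k\<close>. For surjectivity the cycle is undone and
  the result is shifted down by two.\<close>

lemma extend_perm_bij:
  "bij_betw (\<lambda>(k, \<sigma>). extend_perm n k \<sigma>) ({2..2*n + 2} \<times> matching_perms n) (matching_perms (Suc n))"
proof (rule bij_betw_imageI)
  have perm: "\<sigma> permutes {1..2*n}" if "\<sigma> \<in> matching_perms n" for \<sigma>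
    using that by (simp add: matching_perms_def)
  show "inj_on (\<lambda>(k, \<sigma>). extend_perm n k \<sigma>) ({2..2*n + 2} \<times> matching_perms n)"
  proof (rule inj_onI, clarify)
    fix k \<sigma> l \<tau>
    assume k: "k \<in> {2..2*n + 2}" and l: "l \<in> {2..2*n + 2}"
      and \<sigma>: "\<sigma> \<in> matching_perms n" and \<tau>: "\<tau> \<in> matching_perms n"
      and eq: "extend_perm n k \<sigma> = extend_perm n l \<tau>"
    have "k = l"
      using extend_perm_simps(2)[OF perm k, OF \<sigma>] extend_perm_simps(2)[OF perm l, OF \<tau>] eq by simp
    moreover have "\<sigma> i = \<tau> i" for i
    proof (cases "i \<in> {1..2*n}")
      case True
      then have "skip_index k (\<sigma> i) = skip_index k (\<tau> i)"
        using extend_perm_simps(3)[OF perm k, OF \<sigma> True] extend_perm_simps(3)[OF perm l, OF \<tau> True]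
          eq \<open>k = l\<close> by simp
      then show ?thesis
        by (metis skip_index_less_iff less_irrefl linorder_neqE_nat)
    next
      case False
      then show ?thesis
        using permutes_not_in[OF perm[OF \<sigma>]] permutes_not_in[OF perm[OF \<tau>]] by simp
    qed
    ultimately show "k = l \<and> \<sigma> = \<tau>" by auto
  qed
  show "(\<lambda>(k, \<sigma>). extend_perm n k \<sigma>) ` ({2..2*n + 2} \<times> matching_perms n) = matching_perms (Suc n)"
  proof (intro equalityI subsetI)
    fix \<tau> assume \<tau>: "\<tau> \<in> matching_perms (Suc n)"
    then have \<tau>_perm: "\<tau> permutes {1..2 * Suc n}"
      by (simp add: matching_perms_def)
    have \<tau>1: "\<tau> 1 = 1" by (rule matching_perms_first[OF \<tau>])
    define k where "k = \<tau> 2"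
    have "k \<noteq> 1"
      using inj_eq[OF permutes_inj[OF \<tau>_perm], of 2 1] \<tau>1 by (simp add: k_def)
    moreover have "k \<in> {1..2 * Suc n}"
      using permutes_in_image[OF \<tau>_perm, of 2] by (simp add: k_def)
    ultimately have k: "k \<in> {2..2*n + 2}" by auto
    have cyc: "insert_cycle k permutes {2..k}"
      using insert_cycle_permutes_sign[of k] k by simp
    \<comment> \<open>Undoing the cycle leaves a permutation that fixes 1 and 2, so it lives on
      \<open>{3..2*n + 2}\<close> and can be shifted down.\<close>
    define \<rho> where "\<rho> = inv (insert_cycle k) \<circ> \<tau>"
    have \<rho>_perm: "\<rho> permutes {1..2 * Suc n}"
      unfolding \<rho>_def using cyc k
      by (intro permutes_compose[OF \<tau>_perm] permutes_inv permutes_subset[OF cyc]) auto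
    have "insert_cycle k 1 = 1" "insert_cycle k 2 = k"
      by (auto simp: insert_cycle_def)
    then have "\<rho> 1 = 1" "\<rho> 2 = 2"
      unfolding \<rho>_def o_def \<tau>1 k_def[symmetric] by (metis cyc permutes_inv_eq)+
    then have fixed: "\<rho> i = i" if "i \<in> {1..2 * Suc n} - {3..2*n + 2}" for i
    proof -
      have "i = 1 \<or> i = 2" using that by auto
      then show ?thesis using \<open>\<rho> 1 = 1\<close> \<open>\<rho> 2 = 2\<close> by auto
    qed
    have \<rho>_perm': "\<rho> permutes {3..2*n + 2}"
      by (rule permutes_superset[OF \<rho>_perm]) (use fixed in auto)
    have bij: "bij_betw (\<lambda>i. i - 2) {3..2*n + 2} {1..2*n}"
      by (rule bij_betw_byWitness[where f' = "\<lambda>i. i + 2"]) auto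
    define \<sigma> where "\<sigma> = map_permutation {3..2*n + 2} (\<lambda>i. i - 2) \<rho>"
    have \<sigma>_perm: "\<sigma> permutes {1..2*n}"
      unfolding \<sigma>_def by (rule map_permutation_permutes[OF bij \<rho>_perm'])
    have "map_permutation {1..2*n} (\<lambda>i. i + 2) \<sigma> = \<rho>"
      unfolding \<sigma>_def by (rule map_permutation_compose_inv[OF bij \<rho>_perm']) auto
    then have E: "extend_perm n k \<sigma> = \<tau>"
      unfolding extend_perm_def \<rho>_def
      by (simp add: fun_eq_iff permutes_inverses[OF cyc])
    then have "\<sigma> \<in> matching_perms n"
      using extend_perm_in_matching_perms_iff[OF \<sigma>_perm k] \<tau> by simp
    then show "\<tau> \<in> (\<lambda>(k, \<sigma>). extend_perm n k \<sigma>) ` ({2..2*n + 2} \<times> matching_perms n)"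
      using k E by force
  next
    fix \<tau> assume "\<tau> \<in> (\<lambda>(k, \<sigma>). extend_perm n k \<sigma>) ` ({2..2*n + 2} \<times> matching_perms n)"
    then obtain k \<sigma> where "k \<in> {2..2*n + 2}" "\<sigma> \<in> matching_perms n" "\<tau> = extend_perm n k \<sigma>"
      by (auto simp del: atLeastAtMost_iff)
    then show "\<tau> \<in> matching_perms (Suc n)"
      using extend_perm_in_matching_perms_iff[OF perm] by blast
  qed
qed

lemma matching_perms_0: "matching_perms 0 = {id}"
  by (auto simp: matching_perms_def)

lemma sum_matching_perms_Suc:
  "(\<Sum>\<tau>\<in>matching_perms (Suc n). f \<tau>)
    = (\<Sum>k=2..2*n + 2. \<Sum>\<sigma>\<in>matching_perms n. f (extend_perm n k \<sigma>))"
  by (simp add: sum.reindex_bij_betw[OF extend_perm_bij, symmetric] sum.cartesian_product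
      case_prod_unfold)

lemma prod_extend_perm:
  assumes "\<sigma> \<in> matching_perms n" "k \<in> {2..2*n + 2}"
  shows "(\<Prod>i=1..Suc n. A (extend_perm n k \<sigma> (2*i - 1)) (extend_perm n k \<sigma> (2*i)))
    = A 1 k * (\<Prod>i=1..n. A (skip_index k (\<sigma> (2*i - 1))) (skip_index k (\<sigma> (2*i))))"
proof -
  let ?E = "extend_perm n k \<sigma>"
  have \<sigma>: "\<sigma> permutes {1..2*n}"
    using assms by (simp add: matching_perms_def)
  have "(\<Prod>i=1..Suc n. A (?E (2*i - 1)) (?E (2*i)))
      = A (?E (2*1 - 1)) (?E (2*1)) * (\<Prod>i=1..n. A (?E (2 * Suc i - 1)) (?E (2 * Suc i)))"
    by (simp add: prod.atLeast_Suc_atMost prod.atLeast_Suc_atMost_Suc_shift numeral_2_eq_2 del: prod.cl_ivl_Suc)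
  also have "(\<Prod>i=1..n. A (?E (2 * Suc i - 1)) (?E (2 * Suc i)))
      = (\<Prod>i=1..n. A (skip_index k (\<sigma> (2*i - 1))) (skip_index k (\<sigma> (2*i))))"
  proof (rule prod.cong[OF refl])
    fix i assume i: "i \<in> {1..n}"
    have "?E (2 * i - 1 + 2) = skip_index k (\<sigma> (2*i - 1))" "?E (2 * i + 2) = skip_index k (\<sigma> (2*i))"
      using i by (intro extend_perm_simps(3)[OF \<sigma> assms(2)]; force)+
    moreover have "2 * Suc i - 1 = 2 * i - 1 + 2" "2 * Suc i = 2 * i + 2"
      using i by auto
    ultimately show "A (?E (2 * Suc i - 1)) (?E (2 * Suc i)) = A (skip_index k (\<sigma> (2*i - 1))) (skip_index k (\<sigma> (2*i)))"
      by metis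
  qed
  finally show ?thesis
    using extend_perm_simps(1,2)[OF \<sigma> assms(2)] by simp
qed

text \<open>Expansion along the first row, obtained by sorting the matchings by the partner
  \<open>k\<close> of 1.\<close>

lemma hafnian_Suc:
  "hafnian (Suc n) A = (\<Sum>k=2..2*n + 2. A 1 k * hafnian n (\<lambda>i j. A (skip_index k i) (skip_index k j)))"
  unfolding hafnian_def sum_matching_perms_Suc sum_distrib_left
  by (intro sum.cong refl prod_extend_perm)

text \<open>The same sorting; the alternating sign is that of the inserted cycle.\<close>

lemma pfaffian_Suc:
  "pfaffian (Suc n) A
    = (\<Sum>k=2..2*n + 2. (-1) ^ k * A 1 k * pfaffian n (\<lambda>i j. A (skip_index k i) (skip_index k j)))"
  unfolding pfaffian_def sum_matching_perms_Suc sum_distrib_left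
proof (intro sum.cong refl)
  fix k \<sigma> assume k: "k \<in> {2..2*n + 2}" and \<sigma>: "\<sigma> \<in> matching_perms n"
  then have "sign (extend_perm n k \<sigma>) = (-1) ^ k * sign \<sigma>"
    by (intro sign_extend_perm) (auto simp: matching_perms_def)
  then show "of_int (sign (extend_perm n k \<sigma>))
      * (\<Prod>i=1..Suc n. A (extend_perm n k \<sigma> (2*i - 1)) (extend_perm n k \<sigma> (2*i)))
    = (-1) ^ k * A 1 k * (of_int (sign \<sigma>) * (\<Prod>i=1..n. A (skip_index k (\<sigma> (2*i - 1))) (skip_index k (\<sigma> (2*i)))))"
    unfolding prod_extend_perm[OF \<sigma> k] by (simp add: mult_ac)
qed

section \<open>Increasing enumerations of finite index sets\<close>

lemma strict_mono_on_skip_index: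
  fixes e :: "nat \<Rightarrow> 'i::linorder"
  assumes e: "strict_mono_on {1..2*n + 2} e" and k: "k \<in> {2..2*n + 2}"
  shows "strict_mono_on {1..2*n} (e \<circ> skip_index k)"
    and "(e \<circ> skip_index k) ` {1..2*n} = e ` {1..2*n + 2} - {e 1, e k}"
proof -
  have inj: "inj_on e {1..2*n + 2}"
    by (rule strict_mono_on_imp_inj_on[OF e])
  show "strict_mono_on {1..2*n} (e \<circ> skip_index k)"
  proof (rule strict_mono_onI)
    fix i j assume ij: "i \<in> {1..2*n}" "j \<in> {1..2*n}" "i < j"
    have "skip_index k i \<in> {1..2*n + 2}" "skip_index k j \<in> {1..2*n + 2}"
      using ij skip_index_image[OF k] by (auto simp: skip_index_def)
    then show "(e \<circ> skip_index k) i < (e \<circ> skip_index k) j"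
      using ij skip_index_less_iff strict_mono_onD[OF e] by auto
  qed
  have "{2..2*n + 2} - {k} = {1..2*n + 2} - {1, k}" by auto
  then show "(e \<circ> skip_index k) ` {1..2*n} = e ` {1..2*n + 2} - {e 1, e k}"
    unfolding image_comp[symmetric] skip_index_image[OF k]
    using inj_on_image_set_diff[OF inj, of "{1..2*n + 2}" "{1, k}"] k by simp
qed

lemma Min_strict_mono_image:
  fixes e :: "nat \<Rightarrow> 'i::linorder"
  assumes e: "strict_mono_on {1..2*n + 2} e"
  shows "Min (e ` {1..2*n + 2}) = e 1" "e ` {1..2*n + 2} - {e 1} = e ` {2..2*n + 2}"
proof -
  have less: "e 1 < y" if "y \<in> e ` {2..2*n + 2}" for y
    using that by (auto intro!: strict_mono_onD[OF e])
  have eq: "e ` {1..2*n + 2} = insert (e 1) (e ` {2..2*n + 2})"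
  proof -
    have "{1..2*n + 2} = insert 1 {2..2*n + 2}" by auto
    then show ?thesis by (metis image_insert)
  qed
  show "Min (e ` {1..2*n + 2}) = e 1"
    unfolding eq by (rule Min_eqI) (use less in \<open>auto simp: less_imp_le simp del: image_iff\<close>)
  show "e ` {1..2*n + 2} - {e 1} = e ` {2..2*n + 2}"
    unfolding eq using less by blast
qed

text \<open>Both sides obey the same recursion. An arbitrary increasing \<open>e\<close> is needed
  because the smaller matrices are indexed through \<open>e\<close> composed with
  \<open>skip_index k\<close>.\<close>

lemma hafnian_eq_set_hafnian:
  assumes "strict_mono_on {1..2*n} e"
  shows "hafnian n (\<lambda>i j. A (e i) (e j)) = set_hafnian A n (e ` {1..2*n})"
  using assms
proof (induction n arbitrary: e)
  case 0
  then show ?case by (simp add: hafnian_def matching_perms_0)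
next
  case (Suc n e)
  have e: "strict_mono_on {1..2*n + 2} e" and S: "{1..2 * Suc n} = {1..2*n + 2}"
    using Suc.prems by simp_all
  have inj: "inj_on e {2..2*n + 2}"
    using strict_mono_on_imp_inj_on[OF e] by (rule inj_on_subset) auto
  have "hafnian (Suc n) (\<lambda>i j. A (e i) (e j))
      = (\<Sum>k=2..2*n + 2. A (e 1) (e k) * set_hafnian A n (e ` {1..2*n + 2} - {e 1, e k}))"
    unfolding hafnian_Suc
  proof (intro sum.cong refl)
    fix k assume k: "k \<in> {2..2*n + 2}"
    show "A (e 1) (e k) * hafnian n (\<lambda>i j. A (e (skip_index k i)) (e (skip_index k j)))
        = A (e 1) (e k) * set_hafnian A n (e ` {1..2*n + 2} - {e 1, e k})"
      using Suc.IH[OF strict_mono_on_skip_index(1)[OF e k]]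
      unfolding strict_mono_on_skip_index(2)[OF e k] by simp
  qed
  also have "\<dots> = set_hafnian A (Suc n) (e ` {1..2*n + 2})"
    unfolding set_hafnian.simps Min_strict_mono_image[OF e] sum.reindex[OF inj] by simp
  finally show ?case unfolding S .
qed

section \<open>Products over pairs and the first identity\<close>

definition prod_pairs :: "('i::linorder \<Rightarrow> 'i \<Rightarrow> 'a::comm_ring_1) \<Rightarrow> 'i set \<Rightarrow> 'a" where
  "prod_pairs r S = (\<Prod>(i, j)\<in>{(i, j). i \<in> S \<and> j \<in> S \<and> i < j}. r i j)"

text \<open>The pairs containing \<open>b\<close> are split off; those with \<open>b\<close> as the
  larger index are reversed, at the cost of one sign each.\<close>

lemma prod_pairs_remove:
  assumes "finite S" "b \<in> S" and anti: "\<And>i j. r i j = - r j i"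
  shows "prod_pairs r S = (-1) ^ card {j\<in>S. j < b} * (\<Prod>j\<in>S - {b}. r b j) * prod_pairs r (S - {b})"
proof -
  let ?P = "{(i, j). i \<in> S - {b} \<and> j \<in> S - {b} \<and> i < j}"
  let ?L = "{j\<in>S. j < b}" and ?R = "{j\<in>S. b < j}"
  have "?P \<subseteq> S \<times> S" by auto
  then have finP: "finite ?P" by (rule finite_subset) (use assms in auto)
  have split: "{(i, j). i \<in> S \<and> j \<in> S \<and> i < j} = ?P \<union> ((\<lambda>j. (j, b)) ` ?L \<union> Pair b ` ?R)"
    using assms by auto
  have "prod_pairs r S = (\<Prod>(i, j)\<in>?P. r i j) * ((\<Prod>(i, j)\<in>(\<lambda>j. (j, b)) ` ?L. r i j) * (\<Prod>(i, j)\<in>Pair b ` ?R. r i j))"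
    unfolding prod_pairs_def split using assms(1) finP
    by (subst prod.union_disjoint, simp, simp, force, subst prod.union_disjoint) auto
  also have "(\<Prod>(i, j)\<in>(\<lambda>j. (j, b)) ` ?L. r i j) = (\<Prod>j\<in>?L. - r b j)"
    by (subst prod.reindex) (auto simp: inj_on_def intro!: prod.cong anti)
  also have "(\<Prod>(i, j)\<in>Pair b ` ?R. r i j) = (\<Prod>j\<in>?R. r b j)"
    by (subst prod.reindex) (auto simp: inj_on_def)
  also have "(\<Prod>j\<in>?L. - r b j) = (-1) ^ card ?L * (\<Prod>j\<in>?L. r b j)"
    by (rule prod_uminus)
  finally have main: "prod_pairs r S = (\<Prod>(i, j)\<in>?P. r i j) *
      ((-1) ^ card ?L * (\<Prod>j\<in>?L. r b j) * (\<Prod>j\<in>?R. r b j))" .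
  have rest: "(\<Prod>j\<in>S - {b}. r b j) = (\<Prod>j\<in>?L. r b j) * (\<Prod>j\<in>?R. r b j)"
  proof -
    have "S - {b} = ?L \<union> ?R" by auto
    then have "(\<Prod>j\<in>S - {b}. r b j) = (\<Prod>j\<in>?L \<union> ?R. r b j)" by (rule arg_cong)
    also have "\<dots> = (\<Prod>j\<in>?L. r b j) * (\<Prod>j\<in>?R. r b j)"
      by (rule prod.union_disjoint) (use assms(1) in auto)
    finally show ?thesis .
  qed
  show ?thesis
    unfolding main rest unfolding prod_pairs_def by (simp only: mult_ac)
qed

context schur_nodes
begin

abbreviation r :: "'i \<Rightarrow> 'i \<Rightarrow> 'a" where "r i j \<equiv> (x i - x j) / (x i + x j)"

text \<open>After expansion along the first row and the induction hypothesis,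
  \<open>prod_pairs r S\<close> is factored out of each term. The factors missing from the smaller
  product reappear inverted, as the \<open>s\<close> factors of the twisted expansion.\<close>

lemma pfaffian_eq_set_hafnian:
  assumes "strict_mono_on {1..2*n} e"
  shows "pfaffian n (\<lambda>i j. (x (e i) - x (e j)) / (x (e i) + x (e j))^2)
    = prod_pairs r (e ` {1..2*n}) * H n (e ` {1..2*n})"
  using assms
proof (induction n arbitrary: e)
  case 0
  then show ?case by (simp add: pfaffian_def matching_perms_0 prod_pairs_def)
next
  case (Suc n e)
  have e: "strict_mono_on {1..2*n + 2} e"
    using Suc.prems by simp
  have inj: "inj_on e {1..2*n + 2}"
    by (rule strict_mono_on_imp_inj_on[OF e])
  then have inj2: "inj_on e {2..2*n + 2}"
    by (rule inj_on_subset) auto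
  define S where "S = e ` {1..2*n + 2}"
  define a where "a = e 1"
  have S: "e ` {1..2 * Suc n} = S" by (simp add: S_def)
  have S': "S - {a} = e ` {2..2*n + 2}"
    unfolding S_def a_def by (rule Min_strict_mono_image(2)[OF e])
  have fin: "finite S" and aS: "a \<in> S" and cardS: "card S = 2 * n + 2"
    using inj by (auto simp: S_def a_def card_image)
  have anti: "r i j = - r j i" for i j
    by (metis add.commute minus_diff_eq minus_divide_left)
  have "pfaffian (Suc n) (\<lambda>i j. (x (e i) - x (e j)) / (x (e i) + x (e j))^2)
      = (\<Sum>k=2..2*n + 2. (-1) ^ k * ((x a - x (e k)) / (x a + x (e k))^2)
          * (prod_pairs r (S - {a, e k}) * H n (S - {a, e k})))"
    unfolding pfaffian_Suc a_def
  proof (intro sum.cong refl)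
    fix k assume k: "k \<in> {2..2*n + 2}"
    show "(-1) ^ k * ((x (e 1) - x (e k)) / (x (e 1) + x (e k))^2)
          * pfaffian n (\<lambda>i j. (x (e (skip_index k i)) - x (e (skip_index k j))) / (x (e (skip_index k i)) + x (e (skip_index k j)))^2)
        = (-1) ^ k * ((x (e 1) - x (e k)) / (x (e 1) + x (e k))^2)
          * (prod_pairs r (S - {e 1, e k}) * H n (S - {e 1, e k}))"
      using Suc.IH[OF strict_mono_on_skip_index(1)[OF e k]]
      unfolding strict_mono_on_skip_index(2)[OF e k] S_def by simp
  qed
  also have "\<dots> = (\<Sum>k=2..2*n + 2. prod_pairs r S *
      (w a (e k) * (\<Prod>j\<in>S - {a, e k}. s a j * s (e k) j) * H n (S - {a, e k})))"
  proof (intro sum.cong refl)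
    fix k assume k: "k \<in> {2..2*n + 2}"
    define b where "b = e k"
    define R where "R = S - {a, b}"
    have b: "b \<in> S - {a}" using k by (auto simp: S' b_def)
    have lt: "{j\<in>S. j < a} = {}"
      using Min_le[OF fin] Min_strict_mono_image(1)[OF e]
      unfolding S_def[symmetric] a_def[symmetric] by (auto simp: not_less)
    have "e i < e k \<longleftrightarrow> i < k" if "i \<in> {2..2*n + 2}" for i
      by (rule strict_mono_on_less[OF e]) (use that k in auto)
    then have "{j \<in> e ` {2..2*n + 2}. j < e k} = e ` {i \<in> {2..2*n + 2}. i < k}"
      by blast
    also have "{i \<in> {2..2*n + 2}. i < k} = {2..<k}"
      using k by auto
    finally have "{j\<in>S - {a}. j < b} = e ` {2..<k}"
      unfolding S' b_def .
    moreover have "inj_on e {2..<k}"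
      by (rule inj_on_subset[OF inj2]) (use k in auto)
    ultimately have card_lt: "card {j\<in>S - {a}. j < b} = k - 2"
      by (simp only: card_image card_atLeastLessThan)
    have R: "S - {a} - {b} = R" by (auto simp: R_def)
    have "prod_pairs r S = (\<Prod>j\<in>S - {a}. r a j) * prod_pairs r (S - {a})"
      using prod_pairs_remove[of S a r, OF fin aS anti] by (simp add: lt)
    also have "prod_pairs r (S - {a}) = (-1) ^ (k - 2) * (\<Prod>j\<in>R. r b j) * prod_pairs r R"
      using prod_pairs_remove[of "S - {a}" b r, OF _ b anti] fin
      unfolding card_lt R by simp
    \<comment> \<open>Here \<open>k\<close> is at least 2, so the subtraction is genuine and
      preserves parity. The sign from removing \<open>b\<close> thus equals the sign in the Pfaffian
      expansion.\<close>
    also have "(-1) ^ (k - 2) = ((-1) ^ k :: 'a)"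
      using k by (auto simp: minus_one_power_iff)
    also have "(\<Prod>j\<in>S - {a}. r a j) = r a b * (\<Prod>j\<in>R. r a j)"
      using prod.remove[of "S - {a}" b "r a"] fin b unfolding R by simp
    finally have P: "prod_pairs r S
        = r a b * (\<Prod>j\<in>R. r a j) * ((-1) ^ k * (\<Prod>j\<in>R. r b j) * prod_pairs r R)" .
    \<comment> \<open>Off the diagonal \<open>r\<close> and \<open>s\<close> are reciprocal.\<close>
    have inverse: "(\<Prod>j\<in>R. r a j) * (\<Prod>j\<in>R. r b j) * (\<Prod>j\<in>R. s a j * s b j) = 1"
      unfolding prod.distrib[symmetric]
    proof (rule prod.neutral, rule ballI)
      fix j assume "j \<in> R"
      then have "x a - x j \<noteq> 0" "x b - x j \<noteq> 0"
        using distinct by (auto simp: R_def)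
      then show "r a j * r b j * (s a j * s b j) = 1"
        using add_nonzero by simp
    qed
    have "prod_pairs r S * (w a b * (\<Prod>j\<in>R. s a j * s b j) * H n R)
        = (-1) ^ k * (r a b * w a b) * prod_pairs r R * H n R
            * ((\<Prod>j\<in>R. r a j) * (\<Prod>j\<in>R. r b j) * (\<Prod>j\<in>R. s a j * s b j))"
      unfolding P by (simp only: mult_ac)
    also have "\<dots> = (-1) ^ k * ((x a - x b) / (x a + x b)^2) * (prod_pairs r R * H n R)"
      unfolding inverse by (simp add: power2_eq_square)
    finally show "(-1) ^ k * ((x a - x (e k)) / (x a + x (e k))^2)
          * (prod_pairs r (S - {a, e k}) * H n (S - {a, e k}))
        = prod_pairs r S * (w a (e k) * (\<Prod>j\<in>S - {a, e k}. s a j * s (e k) j) * H n (S - {a, e k}))"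
      unfolding b_def R_def by (rule sym)
  qed
  also have "\<dots> = prod_pairs r S * H (Suc n) S"
    unfolding set_hafnian_twisted_expand[OF cardS aS] S' sum.reindex[OF inj2]
    by (simp only: sum_distrib_left o_apply)
  finally show ?case unfolding S .
qed

end

lemma pfaffian_hafnian:
  fixes x :: "nat \<Rightarrow> 'a::field"
  assumes "schur_nodes x"
  shows "pfaffian n (\<lambda>i j. (x i - x j) / (x i + x j)^2)
    = prod_pairs (\<lambda>i j. (x i - x j) / (x i + x j)) {1..2*n} * hafnian n (\<lambda>i j. 1 / (x i + x j))"
proof -
  interpret schur_nodes x by fact
  have mono: "strict_mono_on {1..2*n} (\<lambda>i. i)"
    by (simp add: monotone_on_def)
  show ?thesis
    unfolding pfaffian_eq_set_hafnian[OF mono] hafnian_eq_set_hafnian[OF mono, of w] image_ident ..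
qed

subsection \<open>The substitution x = (1 - y) / (1 + y)\<close>

lemma prod_consecutive_pairs:
  fixes f :: "nat \<Rightarrow> 'a::comm_monoid_mult"
  shows "(\<Prod>i=1..n. f (2*i - 1) * f (2*i)) = (\<Prod>i=1..2*n. f i)"
  by (induction n) (simp_all add: mult_ac)

text \<open>A perfect matching meets every index exactly once, so the weights \<open>u\<close>
  contribute the same product for every \<sigma>.\<close>

lemma matching_perms_prod_scale:
  assumes "\<sigma> \<in> matching_perms n"
  shows "(\<Prod>i=1..n. c * (u (\<sigma> (2*i - 1)) * u (\<sigma> (2*i))) * A (\<sigma> (2*i - 1)) (\<sigma> (2*i)))
    = c ^ n * (\<Prod>i=1..2*n. u i) * (\<Prod>i=1..n. A (\<sigma> (2*i - 1)) (\<sigma> (2*i)) :: 'a::comm_ring_1)"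
proof -
  have "(\<Prod>i=1..n. u (\<sigma> (2*i - 1)) * u (\<sigma> (2*i))) = (\<Prod>i=1..2*n. u (\<sigma> i))"
    by (rule prod_consecutive_pairs)
  also have "\<dots> = (\<Prod>i=1..2*n. u i)"
    using prod.permute[of \<sigma> "{1..2*n}" u] assms by (simp add: matching_perms_def)
  finally show ?thesis
    by (simp only: prod.distrib prod_constant card_atLeastAtMost diff_Suc_1' One_nat_def)
qed

lemma hafnian_scale:
  "hafnian n (\<lambda>i j. c * (u i * u j) * A i j) = c ^ n * (\<Prod>i=1..2*n. u i) * hafnian n A"
  unfolding hafnian_def sum_distrib_left by (intro sum.cong refl matching_perms_prod_scale)

lemma pfaffian_scale:
  "pfaffian n (\<lambda>i j. c * (u i * u j) * A i j) = c ^ n * (\<Prod>i=1..2*n. u i) * pfaffian n A"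
  unfolding pfaffian_def sum_distrib_left
proof (intro sum.cong refl)
  fix \<sigma> assume \<sigma>: "\<sigma> \<in> matching_perms n"
  show "of_int (sign \<sigma>) * (\<Prod>i=1..n. c * (u (\<sigma> (2*i - 1)) * u (\<sigma> (2*i))) * A (\<sigma> (2*i - 1)) (\<sigma> (2*i)))
    = c ^ n * (\<Prod>i=1..2*n. u i) * (of_int (sign \<sigma>) * (\<Prod>i=1..n. A (\<sigma> (2*i - 1)) (\<sigma> (2*i))))"
    unfolding matching_perms_prod_scale[OF \<sigma>] by (simp only: mult_ac)
qed

text \<open>The number of pairs is \<open>n * (2 * n - 1)\<close>, which has the parity of
  \<open>n\<close>.\<close>

lemma prod_pairs_uminus:
  "prod_pairs (\<lambda>i j. - r i j) {1..2*n::nat} = (-1) ^ n * prod_pairs r {1..2*n}"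
proof -
  have split: "prod_pairs r {1..m::nat} = (\<Prod>j=1..m. \<Prod>i\<in>{1..<j}. r i j)" for m r
  proof -
    have "(\<Prod>j=1..m. \<Prod>i\<in>{1..<j}. r i j) = (\<Prod>(j, i)\<in>(SIGMA j:{1..m}. {1..<j}). r i j)"
      by (rule prod.Sigma) auto
    also have "\<dots> = prod_pairs r {1..m}"
      unfolding prod_pairs_def
      by (rule prod.reindex_bij_witness[where i = prod.swap and j = prod.swap]) auto
    finally show ?thesis ..
  qed
  have "(\<Prod>j=1..2*n. (-1) ^ (j - 1)) = ((-1) ^ n :: 'a)"
    by (induction n) simp_all
  then show ?thesis
    unfolding split by (simp add: prod_uminus prod.distrib)
qed

text \<open>Under the substitution, sums and differences of the \<open>x i\<close> become those of
  the second identity up to constants and weights \<open>1 / (u i * u j)\<close>. The scaling lemmas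
  extract these, and they agree on both sides.\<close>

lemma pfaffian_hafnian_one_minus:
  fixes y :: "nat \<Rightarrow> 'a::field"
  assumes two: "(2::'a) \<noteq> 0" and y1: "\<And>i. 1 + y i \<noteq> 0" and y2: "\<And>i j. 1 - y i * y j \<noteq> 0"
    and distinct: "\<And>i j. i \<noteq> j \<Longrightarrow> y i \<noteq> y j"
  shows "pfaffian n (\<lambda>i j. (y i - y j) / (1 - y i * y j)^2)
    = prod_pairs (\<lambda>i j. (y i - y j) / (1 - y i * y j)) {1..2*n}
        * hafnian n (\<lambda>i j. 1 / (1 - y i * y j))"
proof -
  define x where "x i = (1 - y i) / (1 + y i)" for i
  define u where "u i = 1 + y i" for i
  have u: "u i \<noteq> 0" for i using y1 by (simp add: u_def)
  have add: "x i + x j = 2 * (1 - y i * y j) / (u i * u j)" for i j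
    using u[of i] u[of j] unfolding x_def u_def[symmetric]
    by (simp add: divide_simps) (simp add: u_def algebra_simps)
  have diff: "x i - x j = - (2 * (y i - y j) / (u i * u j))" for i j
    using u[of i] u[of j] unfolding x_def u_def[symmetric]
    by (simp add: divide_simps) (simp add: u_def algebra_simps)
  interpret schur_nodes x
  proof
    show "x i + x j \<noteq> 0" for i j
      unfolding add using two y2 u by simp
    show "x i \<noteq> x j" if "i \<noteq> j" for i j
      using diff[of i j] two u distinct[OF that] by auto
  qed
  have 1: "1 / (x i + x j) = (1 / 2) * (u i * u j) * (1 / (1 - y i * y j))" for i j
    unfolding add using two y2 u by simp
  have 2: "(x i - x j) / (x i + x j) = - ((y i - y j) / (1 - y i * y j))" for i j
  proof -
    have "- (2 * p / q) / (2 * d / q) = - (p / d)" if "q \<noteq> 0" for p q d :: 'a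
      using two that by simp
    moreover have "u i * u j \<noteq> 0" using u by simp
    ultimately show ?thesis
      unfolding add diff by blast
  qed
  have 3: "(x i - x j) / (x i + x j)^2 = - (1 / 2) * (u i * u j) * ((y i - y j) / (1 - y i * y j)^2)" for i j
  proof -
    have "p / q^2 = p / q * (1 / q)" for p q :: 'a
      by (simp add: power2_eq_square)
    then have "(x i - x j) / (x i + x j)^2 = (x i - x j) / (x i + x j) * (1 / (x i + x j))" .
    moreover have "- (p / q) * (h * v * (1 / q)) = - h * v * (p / q^2)" for p q h v :: 'a
      by (simp add: power2_eq_square)
    ultimately show ?thesis
      unfolding 1 2 by (rule trans)
  qed
  \<comment> \<open>On the left the whole factor comes from the Pfaffian; on the right the Hafnian
    gives the powers of \<open>1 / 2\<close> and the weights, and the product over pairs gives the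
    sign.\<close>
  define C where "C = (- (1 / 2)) ^ n * (\<Prod>i=1..2*n. u i)"
  have "C * pfaffian n (\<lambda>i j. (y i - y j) / (1 - y i * y j)^2)
      = pfaffian n (\<lambda>i j. (x i - x j) / (x i + x j)^2)"
    unfolding 3 pfaffian_scale C_def ..
  also have "\<dots> = prod_pairs (\<lambda>i j. (x i - x j) / (x i + x j)) {1..2*n} * hafnian n (\<lambda>i j. 1 / (x i + x j))"
    by (rule pfaffian_hafnian) unfold_locales
  also have "\<dots> = C * (prod_pairs (\<lambda>i j. (y i - y j) / (1 - y i * y j)) {1..2*n}
        * hafnian n (\<lambda>i j. 1 / (1 - y i * y j)))"
    unfolding 1 2 hafnian_scale prod_pairs_uminus C_def power_minus[of "1 / 2 :: 'a"] by (simp only: mult_ac)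
  finally show ?thesis
    using u two by (simp add: C_def)
qed

subsection \<open>Indeterminates\<close>

lemma indet_add_nonzero: "indet i + indet j \<noteq> 0"
proof -
  let ?X = "\<lambda>i. Poly_Mapping.single (Poly_Mapping.single i 1) 1 :: mpoly"
  \<comment> \<open>This coefficient is 1, or 2 if \<open>i = j\<close>.\<close>
  have "Poly_Mapping.lookup (?X i + ?X j) (Poly_Mapping.single i 1) \<noteq> 0"
    by (auto simp: lookup_add lookup_single when_def)
  then have "?X i + ?X j \<noteq> 0" by (metis lookup_zero)
  then show ?thesis by (simp add: indet_def Zero_fract_def eq_fract)
qed

lemma indet_eq_iff: "indet i = indet j \<longleftrightarrow> i = j"
proof
  let ?X = "\<lambda>i. Poly_Mapping.single (Poly_Mapping.single i 1) 1 :: mpoly"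
  assume "indet i = indet j"
  then have "?X i = ?X j" by (simp add: indet_def eq_fract)
  then have "Poly_Mapping.lookup (?X i) (Poly_Mapping.single i 1) = Poly_Mapping.lookup (?X j) (Poly_Mapping.single i 1)"
    by simp
  then have eq: "Poly_Mapping.single i (1::nat) = Poly_Mapping.single j 1"
    by (simp add: lookup_single when_def split: if_splits)
  have "Poly_Mapping.lookup (Poly_Mapping.single j (1::nat)) i = 1"
    unfolding eq[symmetric] by simp
  then show "i = j"
    by (simp add: lookup_single when_def split: if_splits)
qed simp

lemma one_plus_indet_nonzero: "1 + indet i \<noteq> 0"
proof -
  let ?X = "\<lambda>i. Poly_Mapping.single (Poly_Mapping.single i 1) 1 :: mpoly"
  have "Poly_Mapping.single i (1::nat) \<noteq> 0"
    by (metis lookup_single_eq lookup_zero one_neq_zero)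
  then have "Poly_Mapping.lookup (1 + ?X i) 0 \<noteq> 0"
    by (simp add: lookup_add lookup_single_not_eq)
  then have "1 + ?X i \<noteq> 0" by (metis lookup_zero)
  then show ?thesis by (simp add: indet_def Zero_fract_def One_fract_def eq_fract)
qed

lemma one_minus_indet_mult_nonzero: "1 - indet i * indet j \<noteq> 0"
proof -
  let ?X = "\<lambda>i. Poly_Mapping.single (Poly_Mapping.single i 1) 1 :: mpoly"
  have "Poly_Mapping.lookup (Poly_Mapping.single i (1::nat) + Poly_Mapping.single j 1) i \<noteq> 0"
    by (simp add: lookup_add)
  then have "Poly_Mapping.single i (1::nat) + Poly_Mapping.single j 1 \<noteq> 0"
    by (metis lookup_zero)
  \<comment> \<open>The constant coefficient is 1, since the monomial of the product has a nonzero
    exponent.\<close>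
  then have "Poly_Mapping.lookup (1 - ?X i * ?X j) 0 \<noteq> 0"
    by (simp add: lookup_minus mult_single lookup_single_not_eq)
  then have "1 - ?X i * ?X j \<noteq> 0" by (metis lookup_zero)
  then show ?thesis by (simp add: indet_def Zero_fract_def One_fract_def eq_fract)
qed

theorem theorem1p1:
  fixes n :: nat
  assumes "n \<ge> 1"
  shows "pfaffian n (\<lambda>i j. (indet i - indet j) / (indet i + indet j)^2)
           = (\<Prod>(i, j)\<in>{(i, j). 1 \<le> i \<and> i < j \<and> j \<le> 2*n}. (indet i - indet j) / (indet i + indet j))
             * hafnian n (\<lambda>i j. 1 / (indet i + indet j))
       \<and> pfaffian n (\<lambda>i j. (indet i - indet j) / (1 - indet i * indet j)^2)
           = (\<Prod>(i, j)\<in>{(i, j). 1 \<le> i \<and> i < j \<and> j \<le> 2*n}. (indet i - indet j) / (1 - indet i * indet j))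
             * hafnian n (\<lambda>i j. 1 / (1 - indet i * indet j))"
proof -
  have pairs: "{(i, j). 1 \<le> i \<and> i < j \<and> j \<le> 2*n} = {(i, j). i \<in> {1..2*n} \<and> j \<in> {1..2*n} \<and> i < j}"
    by auto
  \<comment> \<open>The interpretation also supplies \<open>two_nonzero\<close>, which the second
    identity requires of the field.\<close>
  interpret schur_nodes indet
    by unfold_locales (simp_all add: indet_add_nonzero indet_eq_iff)
  have "schur_nodes indet" ..
  then show ?thesis
    unfolding pairs prod_pairs_def[symmetric]
    using pfaffian_hafnian pfaffian_hafnian_one_minus[of indet]
      two_nonzero one_plus_indet_nonzero one_minus_indet_mult_nonzero
    by (simp add: indet_eq_iff)
qed

end
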